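(* Assume Conjecture A (stated in the context). If a set $\mathcal{M}\subseteq\mathbb{N}$ has a finite-fold Diophantine representation, then $\mathcal{M}$ is computable.
   Context: $\mathbb{N}=\{0,1,2,\ldots\}$. For a positive integer $n$, let $G_n=\{x_i\cdot x_j=x_k : i,j,k\in\{1,\ldots,n\}\}\cup\{x_i+1=x_k : i,k\in\{1,\ldots,n\}\}$, a set of equations in the variables $x_1,\ldots,x_n$. Define $f(1)=1$ and $f(n+1)=2^{2^{f(n)}}$ for every positive integer $n$. Conjecture A: for every positive integer $n$, if a system $\mathcal{S}\subseteq G_n$ has only finitely many solutions in non-negative integers $x_1,\ldots,x_n$, then each such solution $(x_1,\ldots,x_n)$ satisfies $x_1,\ldots,x_n\leqslant f(2n)$. A set $\mathcal{M}\subseteq\mathbb{N}$ has a finite-fold Diophantine representation if there is a polynomial $W(x,x_1,\ldots,x_m)$ with integer coefficients such that for every $b\in\mathbb{N}$: $b\in\mathcal{M}$ if and only if there exist $x_1,\ldots,x_m\in\mathbb{N}$ with $W(b,x_1,\ldots,x_m)=0$; and for every $b\in\mathbb{N}$ the equation $W(b,x_1,\ldots,x_m)=0$ has only finitely many solutions $(x_1,\ldots,x_m)\in\mathbb{N}^m$. *)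

theory Defs
  imports Main "HOL-Library.FuncSet" "HOL-Library.Poly_Mapping"
begin

datatype equation =
    Times nat nat nat  \<comment> \<open>\<open>Times i j k\<close> stands for \<open>x\<^sub>i \<cdot> x\<^sub>j = x\<^sub>k\<close>\<close>
  | Plus_One nat nat   \<comment> \<open>\<open>Plus_One i k\<close> stands for \<open>x\<^sub>i + 1 = x\<^sub>k\<close>\<close>

definition G_eqs :: "nat \<Rightarrow> equation set" where
  "G_eqs n = {Times i j k | i j k. i \<in> {1..n} \<and> j \<in> {1..n} \<and> k \<in> {1..n}}
       \<union> {Plus_One i k | i k. i \<in> {1..n} \<and> k \<in> {1..n}}"

fun satisfies :: "(nat \<Rightarrow> nat) \<Rightarrow> equation \<Rightarrow> bool" where
  "satisfies x (Times i j k) \<longleftrightarrow> x i * x j = x k"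
| "satisfies x (Plus_One i k) \<longleftrightarrow> x i + 1 = x k"

text \<open>
  An \<open>n\<close>-tuple of natural numbers is an extensional function on \<open>{1..n}\<close>, so that
  finiteness of a set of such functions is finiteness of the set of tuples.
\<close>

definition solutions :: "nat \<Rightarrow> equation set \<Rightarrow> (nat \<Rightarrow> nat) set" where
  "solutions n S = {x \<in> {1..n} \<rightarrow>\<^sub>E UNIV. \<forall>e\<in>S. satisfies x e}"

text \<open>The value at \<open>0\<close> is a dummy: the sequence starts at index \<open>1\<close>.\<close>

fun f_seq :: "nat \<Rightarrow> nat" where
  "f_seq 0 = 0"
| "f_seq (Suc 0) = 1"
| "f_seq (Suc (Suc n)) = 2 ^ (2 ^ f_seq (Suc n))"

definition conjecture_A :: bool where
  "conjecture_A \<longleftrightarrow>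
     (\<forall>n\<ge>1. \<forall>S\<subseteq>G_eqs n. finite (solutions n S) \<longrightarrow>
        (\<forall>x\<in>solutions n S. \<forall>i\<in>{1..n}. x i \<le> f_seq (2 * n)))"

text \<open>
  Polynomials with integer coefficients in variables indexed by \<open>nat\<close>: finitely supported
  maps from monomials (finitely supported exponent maps) to coefficients.
\<close>

type_synonym int_mpoly = "(nat \<Rightarrow>\<^sub>0 nat) \<Rightarrow>\<^sub>0 int"

definition variables :: "int_mpoly \<Rightarrow> nat set" where
  "variables W = (\<Union>t\<in>Poly_Mapping.keys W. Poly_Mapping.keys t)"

definition evaluate :: "int_mpoly \<Rightarrow> (nat \<Rightarrow> int) \<Rightarrow> int" where
  "evaluate W v =
     (\<Sum>t\<in>Poly_Mapping.keys W. Poly_Mapping.lookup W t *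
        (\<Prod>i\<in>Poly_Mapping.keys t. v i ^ Poly_Mapping.lookup t i))"

text \<open>
  \<open>roots m W b\<close> is the set of all \<open>(x\<^sub>1, \<dots>, x\<^sub>m)\<close> with \<open>W(b, x\<^sub>1, \<dots>, x\<^sub>m) = 0\<close>;
  variable \<open>0\<close> of \<open>W\<close> plays the role of the parameter \<open>x\<close>.
\<close>

definition roots :: "nat \<Rightarrow> int_mpoly \<Rightarrow> nat \<Rightarrow> (nat \<Rightarrow> nat) set" where
  "roots m W b = {x \<in> {1..m} \<rightarrow>\<^sub>E UNIV. evaluate W (\<lambda>i. int ((x(0 := b)) i)) = 0}"

definition finite_fold_Diophantine :: "nat set \<Rightarrow> bool" where
  "finite_fold_Diophantine M \<longleftrightarrow>
     (\<exists>m W. variables W \<subseteq> {0..m} \<and>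
        (\<forall>b. b \<in> M \<longleftrightarrow> (\<exists>x. x \<in> roots m W b)) \<and>
        (\<forall>b. finite (roots m W b)))"

text \<open>
  Partial recursive functions: \<open>computes p xs y\<close> means that the function described by \<open>p\<close>
  is defined at the argument tuple \<open>xs\<close> with value \<open>y\<close>. \<open>Prim_Rec p q\<close> recurses on the
  first argument; \<open>Minimize p\<close> yields the least \<open>n\<close> with \<open>p(n, xs) = 0\<close>, where
  \<open>p(k, xs)\<close> has to be defined (and nonzero) for all \<open>k < n\<close>.
\<close>

datatype recursive_function =
    Zero
  | Successor
  | Projection nat
  | Compose recursive_function "recursive_function list"
  | Prim_Rec recursive_function recursive_function
  | Minimize recursive_function

inductive computes :: "recursive_function \<Rightarrow> nat list \<Rightarrow> nat \<Rightarrow> bool" where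
  zero: "computes Zero xs 0"
| successor: "computes Successor [x] (Suc x)"
| projection: "i < length xs \<Longrightarrow> computes (Projection i) xs (xs ! i)"
| compose: "list_all2 (\<lambda>q y. computes q xs y) qs ys \<Longrightarrow> computes p ys z
    \<Longrightarrow> computes (Compose p qs) xs z"
| prim_rec_zero: "computes p xs y \<Longrightarrow> computes (Prim_Rec p q) (0 # xs) y"
| prim_rec_Suc: "computes (Prim_Rec p q) (n # xs) y \<Longrightarrow> computes q (n # y # xs) z
    \<Longrightarrow> computes (Prim_Rec p q) (Suc n # xs) z"
| minimize: "computes p (n # xs) 0 \<Longrightarrow> (\<forall>k<n. \<exists>y>0. computes p (k # xs) y)
    \<Longrightarrow> computes (Minimize p) xs n"

lemma computes_deterministic:
  "computes p xs y \<Longrightarrow> computes p xs z \<Longrightarrow> y = z"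
proof (induction arbitrary: z rule: computes.induct)
  case (zero xs)
  then show ?case by (auto elim: computes.cases)
next
  case (successor x)
  then show ?case by (auto elim: computes.cases)
next
  case (projection i xs)
  from projection.prems show ?case by (auto elim: computes.cases)
next
  case (compose xs qs ys p w)
  from compose.prems obtain ys' where ys': "list_all2 (\<lambda>q y. computes q xs y) qs ys'"
    and w': "computes p ys' z" by (auto elim: computes.cases)
  have "ys = ys'"
    using compose.IH(1) ys' by (auto simp: list_all2_conv_all_nth intro!: nth_equalityI)
  with compose.IH w' show ?case by blast
next
  case (prim_rec_zero p xs y q)
  from prim_rec_zero.prems have "computes p xs z" by (auto elim: computes.cases)
  with prim_rec_zero.IH show ?case by blast
next
  case (prim_rec_Suc p q n xs y w)
  from prim_rec_Suc.prems obtain y' where "computes (Prim_Rec p q) (n # xs) y'"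
    and "computes q (n # y' # xs) z" by (auto elim: computes.cases)
  with prim_rec_Suc.IH show ?case by blast
next
  case (minimize p n xs)
  from minimize.prems have z: "computes p (z # xs) 0"
    and less: "\<forall>k<z. \<exists>y>0. computes p (k # xs) y" by (auto elim: computes.cases)
  show ?case
  proof (cases n z rule: linorder_cases)
    case less
    with minimize.IH \<open>\<forall>k<z. \<exists>y>0. computes p (k # xs) y\<close> show ?thesis by (metis less_irrefl)
  next
    case equal
    then show ?thesis .
  next
    case greater
    with minimize.IH z show ?thesis by (metis less_irrefl)
  qed
qed

definition computable :: "nat set \<Rightarrow> bool" where
  "computable M \<longleftrightarrow> (\<exists>p. \<forall>b. computes p [b] (if b \<in> M then 1 else 0))"

end

theory Submission
  imports Defs
begin

text \<open>
  Let \<open>M\<close> be represented by \<open>W\<close> with finitely many roots for each parameter \<open>b\<close>. The equation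
  \<open>W(b, x\<^sub>1, \<dots>, x\<^sub>m) = 0\<close> can be broken up into equations of the two shapes \<open>x\<^sub>i \<cdot> x\<^sub>j = x\<^sub>k\<close> and
  \<open>x\<^sub>i + 1 = x\<^sub>k\<close> by introducing auxiliary variables. What matters is that every auxiliary variable
  is a function of \<open>b, x\<^sub>1, \<dots>, x\<^sub>m\<close>: the solutions of the system then correspond one to one to the
  roots, so the system inherits their finiteness and Conjecture A applies to it. It follows
  (\<open>roots_bounded\<close>) that every root for the parameter \<open>b\<close> is bounded by \<open>f(2n)\<close>, where \<open>n\<close> is the
  number of variables. Only the variables that count up to the constant \<open>b\<close> depend on \<open>b\<close>, hence
  \<open>n = n\<^sub>0 + b + 1\<close> with \<open>n\<^sub>0\<close> determined by \<open>W\<close>, and the bound is a computable function of \<open>b\<close>.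
  Membership of \<open>b\<close> in \<open>M\<close> is therefore decided by trying the finitely many tuples below
  the bound (\<open>computable_if_roots_bounded\<close>).

  There are two technical points. Natural numbers have no subtraction, so \<open>W = 0\<close> is read as
  \<open>P = Q\<close>, where \<open>P\<close> and \<open>Q\<close> collect the positive and the negative coefficients of \<open>W\<close>. And
  addition is not among the equations; it is defined from multiplication and successor by an
  identity of Julia Robinson (\<open>addition_identity\<close>).
\<close>

section \<open>Polynomials with natural coefficients\<close>

text \<open>
  Polynomials with natural coefficients enter the argument twice: as functions definable by
  systems of equations, and as recursive functions. In both cases it suffices to check closure
  under the four operations below.
\<close>

locale semiring_closed =
  fixes C :: "('s \<Rightarrow> nat) \<Rightarrow> bool"
  assumes zero: "C (\<lambda>_. 0)"
    and Suc: "C F \<Longrightarrow> C (\<lambda>s. Suc (F s))"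
    and plus: "C F \<Longrightarrow> C G \<Longrightarrow> C (\<lambda>s. F s + G s)"
    and times: "C F \<Longrightarrow> C G \<Longrightarrow> C (\<lambda>s. F s * G s)"
begin

lemma const: "C (\<lambda>_. c)"
  by (induction c) (simp_all add: zero Suc)

lemma power: "C F \<Longrightarrow> C (\<lambda>s. F s ^ e)"
  by (induction e) (simp_all add: const times)

lemma sum: "finite A \<Longrightarrow> (\<And>i. i \<in> A \<Longrightarrow> C (F i)) \<Longrightarrow> C (\<lambda>s. \<Sum>i\<in>A. F i s)"
  by (induction A rule: finite_induct) (simp_all add: zero plus)

lemma prod: "finite A \<Longrightarrow> (\<And>i. i \<in> A \<Longrightarrow> C (F i)) \<Longrightarrow> C (\<lambda>s. \<Prod>i\<in>A. F i s)"
  by (induction A rule: finite_induct) (simp_all add: const times)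

end

definition nat_poly :: "((nat \<Rightarrow>\<^sub>0 nat) \<Rightarrow> nat) \<Rightarrow> (nat \<Rightarrow>\<^sub>0 nat) set \<Rightarrow> (nat \<Rightarrow> nat) \<Rightarrow> nat" where
  "nat_poly c T x =
     (\<Sum>t\<in>T. c t * (\<Prod>i\<in>Poly_Mapping.keys t. x i ^ Poly_Mapping.lookup t i))"

lemma (in semiring_closed) nat_poly:
  assumes "finite T" and "\<And>i. i \<in> (\<Union>t\<in>T. Poly_Mapping.keys t) \<Longrightarrow> C (\<lambda>s. X s i)"
  shows "C (\<lambda>s. nat_poly c T (X s))"
  unfolding nat_poly_def
  by (intro sum times const prod power assms) (use assms in auto)

lemma nat_poly_cong:
  assumes "\<And>i. i \<in> (\<Union>t\<in>T. Poly_Mapping.keys t) \<Longrightarrow> x i = y i"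
  shows "nat_poly c T x = nat_poly c T y"
  unfolding nat_poly_def
  by (intro sum.cong refl arg_cong2[where f = "(*)"] prod.cong arg_cong2[where f = "(^)"])
    (use assms in blast)

abbreviation positive_part :: "int_mpoly \<Rightarrow> (nat \<Rightarrow> nat) \<Rightarrow> nat" where
  "positive_part W \<equiv> nat_poly (\<lambda>t. nat (Poly_Mapping.lookup W t)) (Poly_Mapping.keys W)"

abbreviation negative_part :: "int_mpoly \<Rightarrow> (nat \<Rightarrow> nat) \<Rightarrow> nat" where
  "negative_part W \<equiv> nat_poly (\<lambda>t. nat (- Poly_Mapping.lookup W t)) (Poly_Mapping.keys W)"

lemma evaluate_eq_0_iff:
  "evaluate W (\<lambda>i. int (x i)) = 0 \<longleftrightarrow> positive_part W x = negative_part W x"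
proof -
  have "evaluate W (\<lambda>i. int (x i)) = int (positive_part W x) - int (negative_part W x)"
    unfolding evaluate_def nat_poly_def of_nat_sum sum_subtractf[symmetric]
    by (intro sum.cong refl) (simp add: left_diff_distrib[symmetric])
  then show ?thesis by simp
qed

lemma roots_iff:
  "x \<in> roots m W b \<longleftrightarrow>
    x \<in> {1..m} \<rightarrow>\<^sub>E UNIV \<and> positive_part W (x(0 := b)) = negative_part W (x(0 := b))"
  unfolding roots_def using evaluate_eq_0_iff[of W "x(0 := b)"] by blast

section \<open>Polynomial functions defined by systems of equations\<close>

text \<open>
  The variables \<open>1, \<dots>, k\<close> are inputs that the system \<open>S\<close> leaves free; the value of each variable
  \<open>i\<close> is forced to be \<open>v i\<close> of the inputs, and these forced values do solve \<open>S\<close>. Restricting the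
  assignment before applying \<open>v i\<close> expresses that the value depends on the inputs alone.
\<close>

definition determines ::
    "nat \<Rightarrow> nat \<Rightarrow> equation set \<Rightarrow> (nat \<Rightarrow> (nat \<Rightarrow> nat) \<Rightarrow> nat) \<Rightarrow> bool" where
  "determines k n S v \<longleftrightarrow> k \<le> n \<and> S \<subseteq> G_eqs n \<and> (\<forall>i\<in>{1..k}. v i = (\<lambda>a. a i)) \<and>
     (\<forall>x. (\<forall>e\<in>S. satisfies x e) \<longleftrightarrow> (\<forall>i\<in>{1..n}. x i = v i (restrict x {1..k})))"

text \<open>
  The function is required to be definable on top of \<^emph>\<open>every\<close> given system, without disturbing its
  variables, so that the systems for two subexpressions can be stacked: the second is built as
  an extension of the first.
\<close>

definition expressible :: "nat \<Rightarrow> ((nat \<Rightarrow> nat) \<Rightarrow> nat) \<Rightarrow> bool" where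
  "expressible k F \<longleftrightarrow> (\<forall>n S v. determines k n S v \<longrightarrow>
     (\<exists>n' S' v'. n \<le> n' \<and> determines k n' S' v' \<and> (\<forall>i\<in>{1..n}. v' i = v i) \<and>
        (\<exists>p\<in>{1..n'}. v' p = F)))"

lemma G_eqs_mono: "n \<le> n' \<Longrightarrow> G_eqs n \<subseteq> G_eqs n'"
  by (fastforce simp: G_eqs_def)

lemma Times_in_G_eqs [simp]:
    "Times i j k \<in> G_eqs n \<longleftrightarrow> i \<in> {1..n} \<and> j \<in> {1..n} \<and> k \<in> {1..n}"
  and Plus_One_in_G_eqs [simp]: "Plus_One i k \<in> G_eqs n \<longleftrightarrow> i \<in> {1..n} \<and> k \<in> {1..n}"
  by (auto simp: G_eqs_def)

lemma determines_inputs: "determines k k {} (\<lambda>i a. a i)"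
  by (simp add: determines_def)

text \<open>
  Forced values are preserved by adding a block of new variables \<open>n + 1, n + 2, \<dots>\<close> whose equations
  have exactly one solution once the old variables are known. Whole blocks are needed, because
  within a block a variable may be forced only by the interplay of several equations, as
  happens for zero and for sums.
\<close>

lemma determines_extend:
  assumes det: "determines k n S v"
    and T: "T \<subseteq> G_eqs (n + length ws)"
    and unique: "\<And>x. \<forall>i\<in>{1..n}. x i = v i (restrict x {1..k}) \<Longrightarrow>
      (\<forall>e\<in>T. satisfies x e) \<longleftrightarrow>
      (\<forall>j<length ws. x (Suc (n + j)) = (ws ! j) (restrict x {1..k}))"
  shows "determines k (n + length ws) (S \<union> T) (\<lambda>i. if i \<le> n then v i else ws ! (i - Suc n))"
    (is "determines k ?n _ ?v")
proof -
  have "(\<forall>e\<in>S \<union> T. satisfies x e) \<longleftrightarrow> (\<forall>i\<in>{1..?n}. x i = ?v i (restrict x {1..k}))" for x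
  proof -
    let ?a = "restrict x {1..k}"
    have "(\<forall>i\<in>{1..?n}. x i = ?v i ?a) \<longleftrightarrow>
        (\<forall>i\<in>{1..n}. x i = v i ?a) \<and> (\<forall>j<length ws. x (Suc (n + j)) = (ws ! j) ?a)"
      (is "?L \<longleftrightarrow> ?R1 \<and> ?R2")
    proof
      assume L: ?L
      have "x i = v i ?a" if "i \<in> {1..n}" for i
        using L[rule_format, of i] that by simp
      moreover have "x (Suc (n + j)) = (ws ! j) ?a" if "j < length ws" for j
        using L[rule_format, of "Suc (n + j)"] that by simp
      ultimately show "?R1 \<and> ?R2" by blast
    next
      assume R: "?R1 \<and> ?R2"
      show ?L
      proof
        fix i assume i: "i \<in> {1..?n}"
        show "x i = ?v i ?a"
        proof (cases "i \<le> n")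
          case True
          then show ?thesis using R i by simp
        next
          case False
          then have "i - Suc n < length ws" "Suc (n + (i - Suc n)) = i" using i by auto
          then show ?thesis using R False by metis
        qed
      qed
    qed
    moreover have "(\<forall>e\<in>S. satisfies x e) \<longleftrightarrow> (\<forall>i\<in>{1..n}. x i = v i ?a)"
      using det unfolding determines_def by blast
    ultimately show ?thesis using unique[of x] by (simp only: ball_Un) blast
  qed
  moreover have "S \<union> T \<subseteq> G_eqs ?n"
    using det T G_eqs_mono[of n ?n] unfolding determines_def by auto
  ultimately show ?thesis using det unfolding determines_def by auto
qed

lemma expressibleI:
  assumes "\<And>n S v. determines k n S v \<Longrightarrow> \<exists>n' S' v'. n \<le> n' \<and> determines k n' S' v' \<and>
     (\<forall>i\<in>{1..n}. v' i = v i) \<and> (\<exists>p\<in>{1..n'}. v' p = F)"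
  shows "expressible k F"
  using assms unfolding expressible_def by blast

lemma expressibleE:
  assumes "expressible k F" and "determines k n S v"
  obtains n' S' v' p where "n \<le> n'" "determines k n' S' v'" "\<forall>i\<in>{1..n}. v' i = v i"
    "p \<in> {1..n'}" "v' p = F"
  using assms unfolding expressible_def by blast

text \<open>
  The block \<open>T n p q\<close> occupies the variables after \<open>n\<close> and reads its two arguments from variables
  \<open>p\<close> and \<open>q\<close>; one of its variables carries the result.
\<close>

lemma expressible_by_gadget:
  assumes F: "expressible k F" and G: "expressible k G" and r: "r < length ws"
    and T: "\<And>n p q. p \<in> {1..n} \<Longrightarrow> q \<in> {1..n} \<Longrightarrow> T n p q \<subseteq> G_eqs (n + length ws)"
    and unique: "\<And>n p q x a. x p = F a \<Longrightarrow> x q = G a \<Longrightarrow>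
      (\<forall>e\<in>T n p q. satisfies x e) \<longleftrightarrow> (\<forall>j<length ws. x (Suc (n + j)) = (ws ! j) a)"
  shows "expressible k (ws ! r)"
proof (rule expressibleI)
  fix n S v assume "determines k n S v"
  with F obtain n1 S1 v1 p where 1: "n \<le> n1" "determines k n1 S1 v1" "\<forall>i\<in>{1..n}. v1 i = v i"
    "p \<in> {1..n1}" "v1 p = F" by (rule expressibleE)
  from G 1(2) obtain n2 S2 v2 q where 2: "n1 \<le> n2" "determines k n2 S2 v2"
    "\<forall>i\<in>{1..n1}. v2 i = v1 i" "q \<in> {1..n2}" "v2 q = G" by (rule expressibleE)
  have p: "p \<in> {1..n2}" "v2 p = F" using 1 2 by auto
  let ?v = "\<lambda>i. if i \<le> n2 then v2 i else ws ! (i - Suc n2)"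
  have det: "determines k (n2 + length ws) (S2 \<union> T n2 p q) ?v"
  proof (rule determines_extend[OF 2(2) T[OF p(1) 2(4)]])
    fix x assume "\<forall>i\<in>{1..n2}. x i = v2 i (restrict x {1..k})"
    then show "(\<forall>e\<in>T n2 p q. satisfies x e) \<longleftrightarrow>
        (\<forall>j<length ws. x (Suc (n2 + j)) = (ws ! j) (restrict x {1..k}))"
      using p 2(4,5) by (intro unique) auto
  qed
  have "\<forall>i\<in>{1..n}. ?v i = v i" using 1 2 by auto
  moreover have "Suc (n2 + r) \<in> {1..n2 + length ws}" "?v (Suc (n2 + r)) = ws ! r"
    using r by auto
  moreover have "n \<le> n2 + length ws" using 1 2 by simp
  ultimately show "\<exists>n' S' v'. n \<le> n' \<and> determines k n' S' v' \<and>
     (\<forall>i\<in>{1..n}. v' i = v i) \<and> (\<exists>p\<in>{1..n'}. v' p = ws ! r)"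
    using det by blast
qed

lemma expressible_input:
  assumes "i \<in> {1..k}"
  shows "expressible k (\<lambda>a. a i)"
proof (rule expressibleI)
  fix n S v assume "determines k n S v"
  moreover from this have "i \<in> {1..n}" "v i = (\<lambda>a. a i)"
    using assms unfolding determines_def by auto
  ultimately show "\<exists>n' S' v'. n \<le> n' \<and> determines k n' S' v' \<and>
     (\<forall>i\<in>{1..n}. v' i = v i) \<and> (\<exists>p\<in>{1..n'}. v' p = (\<lambda>a. a i))"
    by blast
qed

text \<open>
  The equations \<open>z + 1 = u\<close> and \<open>u \<cdot> u = u\<close> force \<open>u = 1\<close> and \<open>z = 0\<close>, since \<open>u\<close> is idempotent and positive.
\<close>

lemma expressible_zero: "expressible k (\<lambda>_. 0)"
proof (rule expressibleI)
  fix n S v assume det: "determines k n S v"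
  let ?ws = "[\<lambda>_. 0, \<lambda>_. 1] :: ((nat \<Rightarrow> nat) \<Rightarrow> nat) list"
  let ?v = "\<lambda>i. if i \<le> n then v i else ?ws ! (i - Suc n)"
  let ?T = "{Plus_One (Suc n) (Suc (Suc n)), Times (Suc (Suc n)) (Suc (Suc n)) (Suc (Suc n))}"
  have "determines k (n + length ?ws) (S \<union> ?T) ?v"
    by (rule determines_extend[OF det]) (auto simp: All_less_Suc2)
  moreover have "?v (Suc n) = (\<lambda>_. 0)" "Suc n \<in> {1..n + length ?ws}" "n \<le> n + length ?ws"
    by auto
  moreover have "\<forall>i\<in>{1..n}. ?v i = v i" by auto
  ultimately show "\<exists>n' S' v'. n \<le> n' \<and> determines k n' S' v' \<and>
     (\<forall>i\<in>{1..n}. v' i = v i) \<and> (\<exists>p\<in>{1..n'}. v' p = (\<lambda>_. 0))"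
    by blast
qed

lemma expressible_Suc:
  assumes "expressible k F"
  shows "expressible k (\<lambda>a. Suc (F a))"
proof -
  have "expressible k ([\<lambda>a. Suc (F a)] ! 0)"
    by (rule expressible_by_gadget[OF assms assms, where T = "\<lambda>n p q. {Plus_One p (Suc n)}"]) auto
  then show ?thesis by simp
qed

lemma expressible_times:
  assumes "expressible k F" and "expressible k G"
  shows "expressible k (\<lambda>a. F a * G a)"
proof -
  have "expressible k ([\<lambda>a. F a * G a] ! 0)"
    by (rule expressible_by_gadget[OF assms, where T = "\<lambda>n p q. {Times p q (Suc n)}"]) auto
  then show ?thesis by simp
qed

text \<open>
  After cancelling the common terms, the identity says \<open>z \<cdot> (x + y) = z \<cdot> z\<close>. It characterises sums
  by products and successors, except in the degenerate case \<open>z = 0\<close>.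
\<close>

lemma addition_identity:
  fixes x y z :: nat
  shows "(x * z + 1) * (y * z + 1) = z * z * (x * y + 1) + 1 \<longleftrightarrow> z = 0 \<or> z = x + y"
proof -
  have "(x * z + 1) * (y * z + 1) = z * z * (x * y + 1) + 1 \<longleftrightarrow> z * (x + y) = z * z"
    by (simp add: algebra_simps)
  then show ?thesis by auto
qed

text \<open>
  The degenerate case is avoided by shifting: \<open>z = x + y\<close> holds iff \<open>Z = x + Y\<close> for \<open>Y = y + 1\<close> and
  \<open>Z = z + 1\<close>, and \<open>Z\<close> is positive. The new variables hold, in this order,
  \<open>Y\<close>, \<open>z\<close>, \<open>Z\<close>, \<open>xZ\<close>, \<open>xZ + 1\<close>, \<open>YZ\<close>, \<open>YZ + 1\<close>, \<open>(xZ + 1)(YZ + 1)\<close>, \<open>xY\<close>, \<open>xY + 1\<close>, \<open>Z\<^sup>2\<close> and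
  \<open>Z\<^sup>2(xY + 1)\<close>; the last equation, which makes the successor of the twelfth equal to the eighth,
  is what forces the value of the second.
\<close>

lemma expressible_plus:
  assumes "expressible k F" and "expressible k G"
  shows "expressible k (\<lambda>a. F a + G a)"
proof -
  let ?ws = "[\<lambda>a. G a + 1, \<lambda>a. F a + G a, \<lambda>a. F a + G a + 1,
    \<lambda>a. F a * (F a + G a + 1), \<lambda>a. F a * (F a + G a + 1) + 1,
    \<lambda>a. (G a + 1) * (F a + G a + 1), \<lambda>a. (G a + 1) * (F a + G a + 1) + 1,
    \<lambda>a. (F a * (F a + G a + 1) + 1) * ((G a + 1) * (F a + G a + 1) + 1),
    \<lambda>a. F a * (G a + 1), \<lambda>a. F a * (G a + 1) + 1,
    \<lambda>a. (F a + G a + 1) * (F a + G a + 1),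
    \<lambda>a. (F a + G a + 1) * (F a + G a + 1) * (F a * (G a + 1) + 1)]"
  let ?T = "\<lambda>n p q. {Plus_One q (n + 1), Plus_One (n + 2) (n + 3),
    Times p (n + 3) (n + 4), Plus_One (n + 4) (n + 5),
    Times (n + 1) (n + 3) (n + 6), Plus_One (n + 6) (n + 7), Times (n + 5) (n + 7) (n + 8),
    Times p (n + 1) (n + 9), Plus_One (n + 9) (n + 10),
    Times (n + 3) (n + 3) (n + 11), Times (n + 11) (n + 10) (n + 12),
    Plus_One (n + 12) (n + 8)}"
  have "expressible k (?ws ! 1)"
  proof (rule expressible_by_gadget[OF assms, where T = ?T])
    fix n p q :: nat assume "p \<in> {1..n}" "q \<in> {1..n}"
    then show "?T n p q \<subseteq> G_eqs (n + length ?ws)" by auto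
  next
    fix n p q :: nat and x a assume pq: "x p = F a" "x q = G a"
    have idx: "Suc (n + 0) = n + 1" "Suc (n + 1) = n + 2" "Suc (n + 2) = n + 3"
      "Suc (n + 3) = n + 4" "Suc (n + 4) = n + 5" "Suc (n + 5) = n + 6" "Suc (n + 6) = n + 7"
      "Suc (n + 7) = n + 8" "Suc (n + 8) = n + 9" "Suc (n + 9) = n + 10"
      "Suc (n + 10) = n + 11" "Suc (n + 11) = n + 12" by simp_all
    have all: "(\<forall>j<length ?ws. Q j) \<longleftrightarrow> Q 0 \<and> Q 1 \<and> Q 2 \<and> Q 3 \<and> Q 4 \<and> Q 5 \<and> Q 6 \<and> Q 7 \<and>
      Q 8 \<and> Q 9 \<and> Q 10 \<and> Q 11" for Q
      by (simp add: All_less_Suc2 numeral_eq_Suc)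
    have R_iff: "(\<forall>j<length ?ws. x (Suc (n + j)) = (?ws ! j) a) \<longleftrightarrow>
       x (n + 1) = G a + 1 \<and>
      x (n + 2) = F a + G a \<and>
      x (n + 3) = F a + G a + 1 \<and>
      x (n + 4) = F a * (F a + G a + 1) \<and>
      x (n + 5) = F a * (F a + G a + 1) + 1 \<and>
      x (n + 6) = (G a + 1) * (F a + G a + 1) \<and>
      x (n + 7) = (G a + 1) * (F a + G a + 1) + 1 \<and>
      x (n + 8) = (F a * (F a + G a + 1) + 1) * ((G a + 1) * (F a + G a + 1) + 1) \<and>
      x (n + 9) = F a * (G a + 1) \<and>
      x (n + 10) = F a * (G a + 1) + 1 \<and>
      x (n + 11) = (F a + G a + 1) * (F a + G a + 1) \<and>
      x (n + 12) = (F a + G a + 1) * (F a + G a + 1) * (F a * (G a + 1) + 1)"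
      unfolding all idx by simp
    show "(\<forall>e\<in>?T n p q. satisfies x e) \<longleftrightarrow> (\<forall>j<length ?ws. x (Suc (n + j)) = (?ws ! j) a)"
      (is "?L \<longleftrightarrow> ?R")
    proof
      assume L: ?L
      then have eqs: "x (n + 1) = G a + 1" "x (n + 3) = x (n + 2) + 1"
        "x (n + 4) = F a * x (n + 3)" "x (n + 5) = x (n + 4) + 1"
        "x (n + 6) = x (n + 1) * x (n + 3)" "x (n + 7) = x (n + 6) + 1"
        "x (n + 8) = x (n + 5) * x (n + 7)" "x (n + 9) = F a * x (n + 1)"
        "x (n + 10) = x (n + 9) + 1" "x (n + 11) = x (n + 3) * x (n + 3)"
        "x (n + 12) = x (n + 11) * x (n + 10)" "x (n + 8) = x (n + 12) + 1"
        using pq by simp_all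
      have "(F a * x (n + 3) + 1) * ((G a + 1) * x (n + 3) + 1)
          = x (n + 3) * x (n + 3) * (F a * (G a + 1) + 1) + 1"
        using eqs by metis
      then have "x (n + 3) = F a + (G a + 1)"
        unfolding addition_identity using eqs(2) by simp
      then have "x (n + 2) = F a + G a" "x (n + 3) = F a + G a + 1" using eqs(2) by simp_all
      then show ?R unfolding R_iff by (intro conjI; simp only: eqs(1,3-11))
    next
      assume R: ?R
      have eqs: "x (n + 1) = G a + 1" "x (n + 2) = F a + G a" "x (n + 3) = F a + G a + 1"
        "x (n + 4) = F a * (F a + G a + 1)" "x (n + 5) = F a * (F a + G a + 1) + 1"
        "x (n + 6) = (G a + 1) * (F a + G a + 1)" "x (n + 7) = (G a + 1) * (F a + G a + 1) + 1"
        "x (n + 8) = (F a * (F a + G a + 1) + 1) * ((G a + 1) * (F a + G a + 1) + 1)"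
        "x (n + 9) = F a * (G a + 1)" "x (n + 10) = F a * (G a + 1) + 1"
        "x (n + 11) = (F a + G a + 1) * (F a + G a + 1)"
        "x (n + 12) = (F a + G a + 1) * (F a + G a + 1) * (F a * (G a + 1) + 1)"
        using R unfolding R_iff by blast+
      have "x (n + 12) + 1 = x (n + 8)"
        using addition_identity[of "F a" "F a + G a + 1" "G a + 1"] unfolding eqs by simp
      with eqs pq show ?L by simp
    qed
  qed simp
  then show ?thesis by simp
qed

lemma semiring_closed_expressible: "semiring_closed (expressible k)"
  by unfold_locales (simp_all add: expressible_zero expressible_Suc expressible_plus expressible_times)

text \<open>
  One system \<open>S\<close>, with inputs \<open>x\<^sub>1, \<dots>, x\<^sub>m\<close> and the parameter as input \<open>m + 1\<close>, serves all \<open>b\<close>. It has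
  variables \<open>p\<close> and \<open>q\<close> for the two halves of the polynomial and a variable \<open>u\<close> for the number \<open>1\<close>.
  To this are added equations for \<open>p = q\<close> and a chain of \<open>b + 1\<close> variables with values \<open>0, 1, \<dots>, b\<close> whose
  last element is identified with the parameter. Equality of two variables is expressed as
  multiplication by \<open>u\<close>. Treating \<open>b\<close> as an input is what makes \<open>n0\<close> independent of \<open>b\<close>.
\<close>

lemma roots_as_solutions:
  assumes W: "variables W \<subseteq> {0..m}"
  shows "\<exists>n0\<ge>m. \<forall>b. \<exists>S\<subseteq>G_eqs (n0 + Suc b). \<exists>ext.
    solutions (n0 + Suc b) S = ext ` roots m W b \<and>
    (\<forall>x\<in>roots m W b. \<forall>i\<in>{1..m}. ext x i = x i)"
proof -
  let ?k = "Suc m"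
  let ?P = "\<lambda>a. positive_part W (a(0 := a ?k))"
  let ?Q = "\<lambda>a. negative_part W (a(0 := a ?k))"
  interpret semiring_closed "expressible ?k" by (rule semiring_closed_expressible)
  \<comment> \<open>Variable \<open>0\<close> of \<open>W\<close> is read from input \<open>m + 1\<close>, because systems have no variable \<open>0\<close>.\<close>
  have input: "expressible ?k (\<lambda>a. (a(0 := a ?k)) i)" if "i \<in> {0..m}" for i
    using that expressible_input[of ?k ?k] expressible_input[of i ?k] by (cases "i = 0") auto
  have "expressible ?k ?P" "expressible ?k ?Q"
    using W by (auto intro!: nat_poly input simp: variables_def simp del: fun_upd_apply)
  from expressibleE[OF this(1) determines_inputs] obtain n1 S1 v1 p where 1:
    "?k \<le> n1" "determines ?k n1 S1 v1" "p \<in> {1..n1}" "v1 p = ?P" .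
  from expressibleE[OF \<open>expressible ?k ?Q\<close> 1(2)] obtain n2 S2 v2 q where 2:
    "n1 \<le> n2" "determines ?k n2 S2 v2" "\<forall>i\<in>{1..n1}. v2 i = v1 i" "q \<in> {1..n2}" "v2 q = ?Q" .
  from expressibleE[OF const[of 1] 2(2)] obtain n S v u where 3:
    "n2 \<le> n" "determines ?k n S v" "\<forall>i\<in>{1..n2}. v i = v2 i" "u \<in> {1..n}" "v u = (\<lambda>_. 1)" .
  have idx: "p \<in> {1..n}" "v p = ?P" "q \<in> {1..n}" "v q = ?Q" "?k \<le> n" using 1 2 3 by auto
  have S: "S \<subseteq> G_eqs n" and v_input: "\<And>i. i \<in> {1..?k} \<Longrightarrow> v i = (\<lambda>a. a i)"
    and sat: "\<And>x. (\<forall>e\<in>S. satisfies x e) \<longleftrightarrow> (\<forall>i\<in>{1..n}. x i = v i (restrict x {1..?k}))"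
    using 3(2) unfolding determines_def by auto
  show ?thesis
  proof (intro exI[of _ n] conjI allI)
    show "m \<le> n" using idx by simp
  next
    fix b
    let ?N = "n + Suc b"
    let ?T = "insert (Times p u q) (insert (Plus_One (Suc n) u) (insert (Times ?N u ?k)
      ((\<lambda>i. Plus_One (n + i) (Suc (n + i))) ` {1..b})))"
    \<comment> \<open>Variable \<open>n + 1 + j\<close> of the chain has the value \<open>j\<close>, whatever the root.\<close>
    let ?ext = "\<lambda>x. \<lambda>i\<in>{1..?N}. if i \<le> n then v i (x(?k := b)) else i - Suc n"
    have restrict_root: "restrict (x(?k := b)) {1..?k} = x(?k := b)"
      if "x \<in> {1..m} \<rightarrow>\<^sub>E UNIV" for x :: "nat \<Rightarrow> nat"
      using that by (auto simp: fun_eq_iff PiE_iff extensional_def)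
    have chain: "(\<forall>e\<in>?T. satisfies x e) \<longleftrightarrow>
        x p = x q \<and> x ?k = b \<and> (\<forall>i\<le>b. x (Suc (n + i)) = i)" if u: "x u = 1" for x
    proof
      assume L: "\<forall>e\<in>?T. satisfies x e"
      have "x (Suc (n + i)) = i" if "i \<le> b" for i
        using that
      proof (induction i)
        case 0
        then show ?case using L u by simp
      next
        case (Suc i)
        then have "Plus_One (n + Suc i) (Suc (n + Suc i)) \<in> ?T" by auto
        then have "x (n + Suc i) + 1 = x (Suc (n + Suc i))" using L by (metis satisfies.simps(2))
        moreover have "x (n + Suc i) = i" using Suc by simp
        ultimately show ?case by linarith
      qed
      then show "x p = x q \<and> x ?k = b \<and> (\<forall>i\<le>b. x (Suc (n + i)) = i)"
        using L u by simp
    next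
      assume R: "x p = x q \<and> x ?k = b \<and> (\<forall>i\<le>b. x (Suc (n + i)) = i)"
      have "x (Suc n) = 0" using R by (metis add_0_right le0)
      moreover have "Suc (x (n + i)) = x (Suc (n + i))" if "i \<in> {1..b}" for i
      proof -
        have "Suc (n + (i - 1)) = n + i" using that by auto
        then have "x (n + i) = i - 1" using R that by (metis atLeastAtMost_iff diff_le_self le_trans)
        then show ?thesis using R that by simp
      qed
      ultimately show "\<forall>e\<in>?T. satisfies x e" using R u by simp
    qed
    have "solutions ?N (S \<union> ?T) = ?ext ` roots m W b"
    proof (intro equalityI subsetI)
      fix x assume x: "x \<in> solutions ?N (S \<union> ?T)"
      let ?a = "restrict x {1..?k}"
      let ?y = "restrict x {1..m}"
      have xE: "x \<in> {1..?N} \<rightarrow>\<^sub>E UNIV" and "\<forall>e\<in>S. satisfies x e" and T: "\<forall>e\<in>?T. satisfies x e"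
        using x unfolding solutions_def by auto
      then have v: "x i = v i ?a" if "i \<in> {1..n}" for i using sat that by blast
      have "x u = 1" using v 3(4,5) by simp
      then have R: "x p = x q" "x ?k = b" "\<forall>i\<le>b. x (Suc (n + i)) = i" using chain T by blast+
      have a: "?a = ?y(?k := b)" using R(2) by (auto simp: fun_eq_iff)
      have "?P ?a = ?Q ?a" using R(1) v idx by metis
      moreover have "?P ?a = positive_part W (?y(0 := b))" "?Q ?a = negative_part W (?y(0 := b))"
        unfolding a using W by (auto intro!: nat_poly_cong simp: variables_def)
      ultimately have "positive_part W (?y(0 := b)) = negative_part W (?y(0 := b))" by metis
      moreover have "?y \<in> {1..m} \<rightarrow>\<^sub>E UNIV" by simp
      ultimately have "?y \<in> roots m W b" unfolding roots_iff by blast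
      moreover have "x = ?ext ?y"
      proof
        fix i
        consider "i \<in> {1..n}" | "i \<in> {Suc n..?N}" | "i \<notin> {1..?N}"
          by (metis atLeastAtMost_iff not_less_eq_eq)
        then show "x i = ?ext ?y i"
        proof cases
          case 1
          then show ?thesis using v a by simp
        next
          case 2
          then have "i - Suc n \<le> b" "Suc (n + (i - Suc n)) = i" by auto
          then have "x i = i - Suc n" using R(3) by metis
          then show ?thesis using 2 by simp
        next
          case 3
          then show ?thesis using PiE_arb[OF xE] by (simp only: restrict_def if_False)
        qed
      qed
      ultimately show "x \<in> ?ext ` roots m W b" by blast
    next
      fix x assume "x \<in> ?ext ` roots m W b"
      then obtain y where y: "y \<in> roots m W b" and x: "x = ?ext y" by blast
      have yE: "y \<in> {1..m} \<rightarrow>\<^sub>E UNIV" and "positive_part W (y(0 := b)) = negative_part W (y(0 := b))"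
        using y unfolding roots_iff by blast+
      moreover have "?P (y(?k := b)) = positive_part W (y(0 := b))"
          "?Q (y(?k := b)) = negative_part W (y(0 := b))"
        using W by (auto intro!: nat_poly_cong simp: variables_def)
      ultimately have PQ: "?P (y(?k := b)) = ?Q (y(?k := b))" by simp
      have xv: "x i = v i (y(?k := b))" if "i \<in> {1..n}" for i using that x by simp
      have a: "restrict x {1..?k} = y(?k := b)"
      proof -
        have "restrict x {1..?k} = restrict (y(?k := b)) {1..?k}"
        proof (rule restrict_ext)
          fix i assume "i \<in> {1..?k}"
          then have "i \<in> {1..n}" "v i = (\<lambda>a. a i)" using v_input idx(5) by auto
          then show "x i = (y(?k := b)) i" using xv by metis
        qed
        then show ?thesis unfolding restrict_root[OF yE] .
      qed
      have "\<forall>e\<in>S. satisfies x e" unfolding sat a using xv by blast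
      moreover have "\<forall>e\<in>?T. satisfies x e"
      proof -
        have "x u = 1" using xv 3(4,5) by simp
        moreover have "x p = x q" using xv idx PQ by metis
        moreover have "x ?k = b" using a by (auto simp: fun_eq_iff split: if_splits)
        moreover have "\<forall>i\<le>b. x (Suc (n + i)) = i" using x by simp
        ultimately show ?thesis using chain by blast
      qed
      moreover have "x \<in> {1..?N} \<rightarrow>\<^sub>E UNIV" unfolding x restrict_PiE_iff by blast
      ultimately show "x \<in> solutions ?N (S \<union> ?T)" unfolding solutions_def by blast
    qed
    moreover have "\<forall>x\<in>roots m W b. \<forall>i\<in>{1..m}. ?ext x i = x i"
      using v_input idx(5) by auto
    moreover have "S \<union> ?T \<subseteq> G_eqs ?N"
      using S G_eqs_mono[of n ?N] idx 3(4) by auto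
    ultimately show "\<exists>S\<subseteq>G_eqs (n + Suc b). \<exists>ext.
      solutions (n + Suc b) S = ext ` roots m W b \<and>
      (\<forall>x\<in>roots m W b. \<forall>i\<in>{1..m}. ext x i = x i)"
      by blast
  qed
qed

text \<open>
  Conjecture A bounds all variables of the system, in particular the inputs, which are the
  coordinates of the root.
\<close>

lemma roots_bounded:
  assumes A: "conjecture_A" and W: "variables W \<subseteq> {0..m}" and fin: "\<forall>b. finite (roots m W b)"
  shows "\<exists>n0. \<forall>b. \<forall>x\<in>roots m W b. \<forall>i\<in>{1..m}. x i \<le> f_seq (2 * (n0 + Suc b))"
proof -
  obtain n0 where n0: "m \<le> n0" and sys: "\<And>b. \<exists>S\<subseteq>G_eqs (n0 + Suc b). \<exists>ext.
    solutions (n0 + Suc b) S = ext ` roots m W b \<and>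
    (\<forall>x\<in>roots m W b. \<forall>i\<in>{1..m}. ext x i = x i)"
    using roots_as_solutions[OF W] by blast
  have "x i \<le> f_seq (2 * (n0 + Suc b))" if x: "x \<in> roots m W b" and i: "i \<in> {1..m}" for b x i
  proof -
    obtain S ext where S: "S \<subseteq> G_eqs (n0 + Suc b)"
      and sol: "solutions (n0 + Suc b) S = ext ` roots m W b"
      and ext: "\<forall>x\<in>roots m W b. \<forall>i\<in>{1..m}. ext x i = x i" using sys[of b] by blast
    have "finite (solutions (n0 + Suc b) S)" unfolding sol using fin by blast
    moreover have "1 \<le> n0 + Suc b" "i \<in> {1..n0 + Suc b}" using i n0 by auto
    ultimately have "ext x i \<le> f_seq (2 * (n0 + Suc b))"
      using A S x sol unfolding conjecture_A_def by blast
    then show ?thesis using ext x i by simp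
  qed
  then show ?thesis by blast
qed

section \<open>Total recursive functions\<close>

text \<open>
  Working with total functions on argument lists of a fixed length replaces reasoning about
  programs by closure properties.
\<close>

definition total_recursive :: "nat \<Rightarrow> (nat list \<Rightarrow> nat) \<Rightarrow> bool" where
  "total_recursive k F \<longleftrightarrow> (\<exists>p. \<forall>xs. length xs = k \<longrightarrow> computes p xs (F xs))"

lemma total_recursive_cong:
  assumes "total_recursive k F" and "\<And>xs. length xs = k \<Longrightarrow> F xs = G xs"
  shows "total_recursive k G"
  using assms unfolding total_recursive_def by auto

lemma total_recursive_zero: "total_recursive k (\<lambda>_. 0)"
  unfolding total_recursive_def using computes.zero by blast

lemma total_recursive_nth: "i < k \<Longrightarrow> total_recursive k (\<lambda>xs. xs ! i)"
  unfolding total_recursive_def using computes.projection by blast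

lemma total_recursive_compose:
  assumes "total_recursive (length Fs) H" and Fs: "\<And>F. F \<in> set Fs \<Longrightarrow> total_recursive k F"
  shows "total_recursive k (\<lambda>xs. H (map (\<lambda>F. F xs) Fs))"
proof -
  obtain p where p: "\<And>ys. length ys = length Fs \<Longrightarrow> computes p ys (H ys)"
    using assms(1) unfolding total_recursive_def by blast
  obtain q where "\<And>F xs. F \<in> set Fs \<Longrightarrow> length xs = k \<Longrightarrow> computes (q F) xs (F xs)"
    using Fs unfolding total_recursive_def by metis
  then have "list_all2 (\<lambda>q y. computes q xs y) (map q Fs) (map (\<lambda>F. F xs) Fs)"
    if "length xs = k" for xs
    using that by (auto simp: list_all2_conv_all_nth)
  then show ?thesis unfolding total_recursive_def using p by (metis computes.compose length_map)
qed

lemma total_recursive_Suc: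
  assumes "total_recursive k F"
  shows "total_recursive k (\<lambda>xs. Suc (F xs))"
proof -
  have "total_recursive (length [F]) (\<lambda>ys. Suc (hd ys))"
    unfolding total_recursive_def
    by (rule exI[of _ Successor]) (auto simp: length_Suc_conv computes.successor)
  from total_recursive_compose[OF this, of k] show ?thesis using assms by simp
qed

lemma total_recursive_reindex:
  assumes "total_recursive (length is) F" and "\<And>i. i \<in> set is \<Longrightarrow> i < k"
  shows "total_recursive k (\<lambda>xs. F (map (\<lambda>i. xs ! i) is))"
proof -
  have "total_recursive k (\<lambda>xs. F (map (\<lambda>F. F xs) (map (\<lambda>i xs. xs ! i) is)))"
    using assms by (intro total_recursive_compose) (auto intro: total_recursive_nth)
  then show ?thesis by (simp add: comp_def)
qed

text \<open>
  Primitive recursion on the value of an arbitrary function \<open>B\<close> of the arguments, rather than on the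
  first argument: the recursor is composed with \<open>B\<close> and all projections.
\<close>

lemma total_recursive_rec:
  assumes P: "total_recursive k P" and Q: "total_recursive (k + 2) Q" and B: "total_recursive k B"
  shows "total_recursive k (\<lambda>xs. rec_nat (P xs) (\<lambda>n y. Q (n # y # xs)) (B xs))"
proof -
  let ?H = "\<lambda>zs. rec_nat (P (tl zs)) (\<lambda>n y. Q (n # y # tl zs)) (hd zs)"
  obtain p q where p: "\<And>xs. length xs = k \<Longrightarrow> computes p xs (P xs)"
    and q: "\<And>zs. length zs = k + 2 \<Longrightarrow> computes q zs (Q zs)"
    using P Q unfolding total_recursive_def by blast
  have "computes (Prim_Rec p q) (b # xs) (?H (b # xs))" if xs: "length xs = k" for b xs
  proof (induction b)
    case 0
    then show ?case using p[OF xs] by (simp add: computes.prim_rec_zero)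
  next
    case (Suc b)
    then show ?case using q[of "b # _ # xs"] xs
      by (auto intro!: computes.prim_rec_Suc)
  qed
  then have "\<forall>zs. length zs = Suc k \<longrightarrow> computes (Prim_Rec p q) zs (?H zs)"
    by (auto simp: length_Suc_conv)
  then have "total_recursive (Suc k) ?H" unfolding total_recursive_def by blast
  then have "total_recursive k (\<lambda>xs. ?H (map (\<lambda>F. F xs) (B # map (\<lambda>i xs. xs ! i) [0..<k])))"
    using B by (intro total_recursive_compose) (auto simp: total_recursive_nth)
  then show ?thesis
  proof (rule total_recursive_cong)
    fix xs :: "nat list" assume "length xs = k"
    then have "map (\<lambda>F. F xs) (B # map (\<lambda>i xs. xs ! i) [0..<k]) = B xs # xs"
      using map_nth[of xs] by (simp add: comp_def)
    then show "?H (map (\<lambda>F. F xs) (B # map (\<lambda>i xs. xs ! i) [0..<k]))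
        = rec_nat (P xs) (\<lambda>n y. Q (n # y # xs)) (B xs)" by simp
  qed
qed

lemma map_nth_drop: "length zs = k + d \<Longrightarrow> map (\<lambda>i. zs ! i) [d..<k + d] = drop d zs"
  by (intro nth_equalityI) auto

lemma total_recursive_drop:
  assumes "total_recursive k F"
  shows "total_recursive (k + d) (\<lambda>zs. F (drop d zs))"
proof (rule total_recursive_cong)
  show "total_recursive (k + d) (\<lambda>zs. F (map (\<lambda>i. zs ! i) [d..<k + d]))"
    using assms by (intro total_recursive_reindex) auto
  show "F (map (\<lambda>i. zs ! i) [d..<k + d]) = F (drop d zs)" if "length zs = k + d" for zs
    using map_nth_drop[OF that] by simp
qed

lemma total_recursive_plus:
  assumes "total_recursive k F" and "total_recursive k G"
  shows "total_recursive k (\<lambda>xs. F xs + G xs)"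
proof (rule total_recursive_cong)
  show "total_recursive k (\<lambda>xs. rec_nat (F xs) (\<lambda>n y. Suc ((n # y # xs) ! 1)) (G xs))"
    by (intro total_recursive_rec total_recursive_Suc total_recursive_nth assms) simp
  have "rec_nat c (\<lambda>n y. Suc y) d = c + d" for c d :: nat by (induction d) auto
  then show "rec_nat (F xs) (\<lambda>n y. Suc ((n # y # xs) ! 1)) (G xs) = F xs + G xs" for xs by simp
qed

lemma total_recursive_times:
  assumes "total_recursive k F" and "total_recursive k G"
  shows "total_recursive k (\<lambda>xs. F xs * G xs)"
proof (rule total_recursive_cong)
  have "total_recursive (k + 2) (\<lambda>zs. zs ! 1 + F (drop 2 zs))"
    by (rule total_recursive_plus[OF total_recursive_nth[of 1 "k + 2"] total_recursive_drop[OF assms(1), of 2]]) linarith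
  then show "total_recursive k (\<lambda>xs. rec_nat 0
      (\<lambda>n y. (n # y # xs) ! 1 + F (drop 2 (n # y # xs))) (G xs))"
    by (rule total_recursive_rec[OF total_recursive_zero _ assms(2)])
  have "rec_nat 0 (\<lambda>n y. y + c) d = c * d" for c d :: nat by (induction d) auto
  then show "rec_nat 0 (\<lambda>n y. (n # y # xs) ! 1 + F (drop 2 (n # y # xs))) (G xs) = F xs * G xs"
    for xs by simp
qed

lemma semiring_closed_total_recursive: "semiring_closed (total_recursive k)"
  by unfold_locales (simp_all add: total_recursive_zero total_recursive_Suc
      total_recursive_plus total_recursive_times)

lemmas total_recursive_const = semiring_closed.const[OF semiring_closed_total_recursive]

lemma total_recursive_pred:
  assumes "total_recursive k F"
  shows "total_recursive k (\<lambda>xs. F xs - 1)"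
proof (rule total_recursive_cong)
  show "total_recursive k (\<lambda>xs. rec_nat 0 (\<lambda>n y. (n # y # xs) ! 0) (F xs))"
    by (intro total_recursive_rec total_recursive_zero total_recursive_nth assms) simp
  show "rec_nat 0 (\<lambda>n y. (n # y # xs) ! 0) (F xs) = F xs - 1" for xs by (cases "F xs") auto
qed

lemma total_recursive_minus:
  assumes "total_recursive k F" and "total_recursive k G"
  shows "total_recursive k (\<lambda>xs. F xs - G xs)"
proof (rule total_recursive_cong)
  show "total_recursive k (\<lambda>xs. rec_nat (F xs) (\<lambda>n y. (n # y # xs) ! 1 - 1) (G xs))"
    by (intro total_recursive_rec[where Q = "\<lambda>zs. zs ! 1 - 1"] total_recursive_pred
        total_recursive_nth assms) simp
  have "rec_nat c (\<lambda>n y. y - 1) d = c - d" for c d :: nat by (induction d) auto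
  then show "rec_nat (F xs) (\<lambda>n y. (n # y # xs) ! 1 - 1) (G xs) = F xs - G xs" for xs by simp
qed

lemma total_recursive_two_power:
  assumes "total_recursive k F"
  shows "total_recursive k (\<lambda>xs. 2 ^ F xs)"
proof (rule total_recursive_cong)
  show "total_recursive k (\<lambda>xs. rec_nat 1 (\<lambda>n y. 2 * (n # y # xs) ! 1) (F xs))"
    by (intro total_recursive_rec[where Q = "\<lambda>zs. 2 * zs ! 1"] total_recursive_const
        total_recursive_times total_recursive_nth assms) simp
  have "rec_nat 1 (\<lambda>n y. 2 * y) d = (2 :: nat) ^ d" for d by (induction d) auto
  then show "rec_nat 1 (\<lambda>n y. 2 * (n # y # xs) ! 1) (F xs) = 2 ^ F xs" for xs by simp
qed

text \<open>The shift by one skips the dummy value \<open>f_seq 0\<close>, which does not fit the recursion.\<close>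

lemma total_recursive_f_seq:
  assumes "total_recursive k F"
  shows "total_recursive k (\<lambda>xs. f_seq (Suc (F xs)))"
proof (rule total_recursive_cong)
  show "total_recursive k (\<lambda>xs. rec_nat 1 (\<lambda>n y. 2 ^ (2 ^ ((n # y # xs) ! 1))) (F xs))"
    by (intro total_recursive_rec[where Q = "\<lambda>zs. 2 ^ (2 ^ (zs ! 1))"] total_recursive_const
        total_recursive_two_power total_recursive_nth assms) simp
  have "rec_nat 1 (\<lambda>n y. 2 ^ (2 ^ y)) d = f_seq (Suc d)" for d :: nat by (induction d) auto
  then show "rec_nat 1 (\<lambda>n y. 2 ^ (2 ^ ((n # y # xs) ! 1))) (F xs) = f_seq (Suc (F xs))"
    for xs by simp
qed

text \<open>
  A bounded product vanishes iff one of its factors does, so this is bounded existential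
  quantification over the first argument.
\<close>

lemma total_recursive_bounded_prod:
  assumes D: "total_recursive (Suc k) D" and B: "total_recursive k B"
  shows "total_recursive k (\<lambda>xs. \<Prod>y\<le>B xs. D (y # xs))"
proof (rule total_recursive_cong)
  have len: "length (0 # [2..<k + 2]) = Suc k" by (simp only: list.size length_upt)
  have "total_recursive (k + 2) (\<lambda>zs. D (map (\<lambda>i. zs ! i) (0 # [2..<k + 2])))"
  proof (rule total_recursive_reindex)
    show "total_recursive (length (0 # [2..<k + 2])) D" unfolding len by (rule D)
  qed auto
  then have "total_recursive (k + 2) (\<lambda>zs. D (zs ! 0 # drop 2 zs))"
  proof (rule total_recursive_cong)
    fix zs :: "nat list" assume "length zs = k + 2"
    then have "map (\<lambda>i. zs ! i) [2..<k + 2] = drop 2 zs" by (rule map_nth_drop)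
    then show "D (map (\<lambda>i. zs ! i) (0 # [2..<k + 2])) = D (zs ! 0 # drop 2 zs)" by simp
  qed
  then show "total_recursive k (\<lambda>xs. rec_nat 1
      (\<lambda>n y. (n # y # xs) ! 1 * D ((n # y # xs) ! 0 # drop 2 (n # y # xs))) (Suc (B xs)))"
    by (intro total_recursive_rec[where Q = "\<lambda>zs. zs ! 1 * D (zs ! 0 # drop 2 zs)"]
        total_recursive_const total_recursive_times total_recursive_nth total_recursive_Suc B) simp
  have "rec_nat 1 (\<lambda>n y. y * E n) d = (\<Prod>y<d. E y)" for d and E :: "nat \<Rightarrow> nat"
    by (induction d) auto
  then show "rec_nat 1 (\<lambda>n y. (n # y # xs) ! 1 * D ((n # y # xs) ! 0 # drop 2 (n # y # xs)))
      (Suc (B xs)) = (\<Prod>y\<le>B xs. D (y # xs))" for xs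
    by (simp only: nth_Cons_0 nth_Cons_Suc One_nat_def drop_Suc_Cons drop_0 numeral_2_eq_2
        lessThan_Suc_atMost)
qed

section \<open>Deciding membership by bounded search\<close>

text \<open>
  Quantifiers are eliminated one at a time, starting with the front of the list, where bounded
  products consume their variable. The parameter \<open>b\<close> stays at the end of the list throughout,
  so that the bound \<open>g b\<close> can be read off at every stage.
\<close>

lemma total_recursive_box_search:
  assumes "total_recursive (Suc m) D" and g: "total_recursive 1 (\<lambda>xs. g (xs ! 0))"
  shows "\<exists>E. total_recursive 1 E \<and> (\<forall>b. E [b] = 0 \<longleftrightarrow>
    (\<exists>ys. length ys = m \<and> (\<forall>y\<in>set ys. y \<le> g b) \<and> D (ys @ [b]) = 0))"
  using assms(1)
proof (induction m arbitrary: D)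
  case 0
  then show ?case by (intro exI[of _ D]) simp
next
  case (Suc m)
  let ?D = "\<lambda>xs. \<Prod>y\<le>g (xs ! m). D (y # xs)"
  have "total_recursive (Suc m) (\<lambda>xs. g (map (\<lambda>i. xs ! i) [m] ! 0))"
    using g by (intro total_recursive_reindex[of "[m]"]) auto
  then have "total_recursive (Suc m) ?D"
    using Suc.prems by (intro total_recursive_bounded_prod) auto
  from Suc.IH[OF this] obtain E where E: "total_recursive 1 E"
    and search: "\<And>b. E [b] = 0 \<longleftrightarrow>
      (\<exists>ys. length ys = m \<and> (\<forall>y\<in>set ys. y \<le> g b) \<and> ?D (ys @ [b]) = 0)" by blast
  have "E [b] = 0 \<longleftrightarrow>
      (\<exists>ys. length ys = Suc m \<and> (\<forall>y\<in>set ys. y \<le> g b) \<and> D (ys @ [b]) = 0)" for b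
  proof -
    have prod_0: "?D (ys @ [b]) = 0 \<longleftrightarrow> (\<exists>y\<le>g b. D (y # ys @ [b]) = 0)" if "length ys = m" for ys
      using that by (auto simp: nth_append)
    show ?thesis
    proof
      assume "E [b] = 0"
      then obtain ys y where "length ys = m" "\<forall>y\<in>set ys. y \<le> g b" "y \<le> g b" "D (y # ys @ [b]) = 0"
        using search prod_0 by metis
      then show "\<exists>ys. length ys = Suc m \<and> (\<forall>y\<in>set ys. y \<le> g b) \<and> D (ys @ [b]) = 0"
        by (intro exI[of _ "y # ys"]) simp
    next
      assume "\<exists>ys. length ys = Suc m \<and> (\<forall>y\<in>set ys. y \<le> g b) \<and> D (ys @ [b]) = 0"
      then obtain y ys where ys: "length ys = m" "\<forall>y\<in>set ys. y \<le> g b"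
        and "y \<le> g b" "D (y # ys @ [b]) = 0"
        by (auto simp: length_Suc_conv)
      then have "?D (ys @ [b]) = 0" unfolding prod_0[OF ys(1)] by blast
      then show "E [b] = 0" using search ys by blast
    qed
  qed
  with E show ?case by blast
qed

text \<open>
  A variable \<open>i\<close> of \<open>W\<close> is stored at position \<open>m - i\<close>, in reverse order, which puts the parameter
  (variable \<open>0\<close>) at the end as the search demands. The function \<open>D\<close> is the absolute difference of the
  two halves of \<open>W\<close>, written with truncated subtraction; it vanishes exactly at the roots.
\<close>

lemma computable_if_roots_bounded:
  assumes W: "variables W \<subseteq> {0..m}"
    and M: "\<And>b. b \<in> M \<longleftrightarrow> (\<exists>x. x \<in> roots m W b)"
    and g: "total_recursive 1 (\<lambda>xs. g (xs ! 0))"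
    and bound: "\<And>b x i. x \<in> roots m W b \<Longrightarrow> i \<in> {1..m} \<Longrightarrow> x i \<le> g b"
  shows "computable M"
proof -
  interpret semiring_closed "total_recursive (Suc m)" by (rule semiring_closed_total_recursive)
  let ?P = "\<lambda>xs. positive_part W (\<lambda>i. xs ! (m - i))"
  let ?Q = "\<lambda>xs. negative_part W (\<lambda>i. xs ! (m - i))"
  define D where "D = (\<lambda>xs. (?P xs - ?Q xs) + (?Q xs - ?P xs))"
  have "total_recursive (Suc m) ?P" "total_recursive (Suc m) ?Q"
    by (auto intro!: nat_poly total_recursive_nth)
  then have "total_recursive (Suc m) D" unfolding D_def by (intro plus total_recursive_minus)
  from total_recursive_box_search[OF this g] obtain E where E: "total_recursive 1 E"
    and search: "\<And>b. E [b] = 0 \<longleftrightarrow>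
      (\<exists>ys. length ys = m \<and> (\<forall>y\<in>set ys. y \<le> g b) \<and> D (ys @ [b]) = 0)" by blast
  have root_iff: "D (ys @ [b]) = 0 \<longleftrightarrow> x \<in> roots m W b"
    if "length ys = m" "x \<in> {1..m} \<rightarrow>\<^sub>E UNIV" "\<And>i. i \<in> {1..m} \<Longrightarrow> x i = ys ! (m - i)" for ys b x
  proof -
    have "(ys @ [b]) ! (m - i) = (x(0 := b)) i" if "i \<in> (\<Union>t\<in>Poly_Mapping.keys W. Poly_Mapping.keys t)" for i
      using W that \<open>length ys = m\<close> \<open>\<And>i. i \<in> {1..m} \<Longrightarrow> x i = ys ! (m - i)\<close>
      by (cases "i = 0") (auto simp: variables_def nth_append)
    then have "nat_poly c (Poly_Mapping.keys W) (\<lambda>i. (ys @ [b]) ! (m - i))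
        = nat_poly c (Poly_Mapping.keys W) (x(0 := b))" for c
      by (rule nat_poly_cong)
    then show ?thesis using that(2) unfolding roots_iff D_def by auto
  qed
  have E_iff: "E [b] = 0 \<longleftrightarrow> b \<in> M" for b
  proof
    assume "E [b] = 0"
    then obtain ys where "length ys = m" "D (ys @ [b]) = 0" using search by blast
    then have "(\<lambda>i\<in>{1..m}. ys ! (m - i)) \<in> roots m W b"
      by (subst root_iff[of ys, symmetric]) auto
    then show "b \<in> M" using M by blast
  next
    assume "b \<in> M"
    then obtain x where x: "x \<in> roots m W b" using M by blast
    let ?ys = "map (\<lambda>j. x (m - j)) [0..<m]"
    have "D (?ys @ [b]) = 0"
      using root_iff[of ?ys x b] x by (auto simp: roots_def)
    moreover have "\<forall>y\<in>set ?ys. y \<le> g b" using bound[OF x] by auto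
    moreover have "length ?ys = m" by simp
    ultimately show "E [b] = 0" using search by blast
  qed
  have "total_recursive 1 (\<lambda>xs. 1 - E xs)"
    by (intro total_recursive_minus total_recursive_const E)
  then obtain p where p: "\<And>b. computes p [b] (1 - E [b])"
    unfolding total_recursive_def by (metis One_nat_def length_Cons list.size(3))
  have "1 - E [b] = (if b \<in> M then 1 else 0)" for b
    using E_iff[of b] by (cases "b \<in> M") (simp_all add: Suc_le_eq)
  with p show ?thesis unfolding computable_def by metis
qed

theorem theorem7:
  fixes M :: "nat set"
  assumes "conjecture_A"
    and "finite_fold_Diophantine M"
  shows "computable M"
proof -
  obtain m W where W: "variables W \<subseteq> {0..m}" and M: "\<And>b. b \<in> M \<longleftrightarrow> (\<exists>x. x \<in> roots m W b)"
    and fin: "\<forall>b. finite (roots m W b)"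
    using assms(2) unfolding finite_fold_Diophantine_def by blast
  obtain n0 where bound: "\<forall>b. \<forall>x\<in>roots m W b. \<forall>i\<in>{1..m}. x i \<le> f_seq (2 * (n0 + Suc b))"
    using roots_bounded[OF assms(1) W fin] by blast
  \<comment> \<open>The index \<open>2 * (n0 + Suc b)\<close> is written as a successor to avoid the dummy value \<open>f_seq 0\<close>.\<close>
  have "total_recursive 1 (\<lambda>xs. f_seq (Suc (2 * n0 + 1 + 2 * xs ! 0)))"
    by (intro total_recursive_f_seq total_recursive_plus total_recursive_times
        total_recursive_const total_recursive_nth) simp
  then have "total_recursive 1 (\<lambda>xs. f_seq (2 * (n0 + Suc (xs ! 0))))"
    by (rule total_recursive_cong) (simp add: algebra_simps)
  with W M show ?thesis using bound by (intro computable_if_roots_bounded[of W m]) auto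
qed

end
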